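(* Let $s_1,\ldots,s_n\in\mathbb{C}$ with $\Re(s_1),\ldots,\Re(s_n)>1$. Then $$\zeta(s_1,\ldots,s_n)=\det[x_{ij}]_{1\le i,j\le n},\qquad \zeta^{\star}(s_1,\ldots,s_n)=\det[y_{ij}]_{1\le i,j\le n},$$ where $$x_{ij}=\begin{cases}\zeta^{\star}(s_j,s_{j-1},\ldots,s_i)& i\le j,\\ 1& i=j+1,\\ 0& i>j+1,\end{cases}\qquad y_{ij}=\begin{cases}\zeta(s_j,s_{j-1},\ldots,s_i)& i\le j,\\ 1& i=j+1,\\ 0& i>j+1.\end{cases}$$
   Context: $\zeta(s_1,\ldots,s_n)=\sum_{0<m_1<\cdots<m_n}\prod_i m_i^{-s_i}$ and $\zeta^{\star}(s_1,\ldots,s_n)=\sum_{0<m_1\le\cdots\le m_n}\prod_i m_i^{-s_i}$, sums over positive integers $m_i$ (absolutely convergent when all $\Re(s_i)\ge 1$ and the last argument has real part $>1$). *)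

theory Defs
  imports
    "HOL-Analysis.Infinite_Sum"
    "HOL-Analysis.Complex_Transcendental"
    "Jordan_Normal_Form.Determinant"
begin

text \<open>Arguments and summation indices are lists: \<open>ss ! k\<close> is the exponent of the
  summation index \<open>ms ! k\<close>, and the last index is the largest one.\<close>

definition mzeta :: "complex list \<Rightarrow> complex" where
  "mzeta ss =
     (\<Sum>\<^sub>\<infinity>ms \<in> {ms :: nat list. length ms = length ss \<and> (\<forall>m \<in> set ms. 0 < m) \<and> sorted_wrt (<) ms}.
        \<Prod>k<length ss. of_nat (ms ! k) powr (- (ss ! k)))"

definition mzeta_star :: "complex list \<Rightarrow> complex" where
  "mzeta_star ss =
     (\<Sum>\<^sub>\<infinity>ms \<in> {ms :: nat list. length ms = length ss \<and> (\<forall>m \<in> set ms. 0 < m) \<and> sorted_wrt (\<le>) ms}.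
        \<Prod>k<length ss. of_nat (ms ! k) powr (- (ss ! k)))"

text \<open>The entry at row \<open>i\<close> and column \<open>j\<close> (counted from 1) takes its arguments in
  decreasing order of index: \<open>s j, s (j - 1), \<dots>, s i\<close>.\<close>

definition x_entry :: "(nat \<Rightarrow> complex) \<Rightarrow> nat \<Rightarrow> nat \<Rightarrow> complex" where
  "x_entry s i j =
     (if i \<le> j then mzeta_star (map s (rev [i..<Suc j])) else if i = j + 1 then 1 else 0)"

definition y_entry :: "(nat \<Rightarrow> complex) \<Rightarrow> nat \<Rightarrow> nat \<Rightarrow> complex" where
  "y_entry s i j =
     (if i \<le> j then mzeta (map s (rev [i..<Suc j])) else if i = j + 1 then 1 else 0)"

end

theory Submission imports Defs begin

text \<open>
  Both formulas are one statement about chains. Fix a relation \<open>R\<close> on index values, with complement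
  \<open>Q\<close>, and weight a word \<open>m\<^sub>0, \<dots>, m\<^sub>n\<^sub>-\<^sub>1\<close> by a product \<open>f\<^sub>0(m\<^sub>0) \<cdots> f\<^sub>n\<^sub>-\<^sub>1(m\<^sub>n\<^sub>-\<^sub>1)\<close>. The sum
  over the words whose neighbours are all related by \<open>R\<close> is the determinant of the Hessenberg
  matrix with ones below the diagonal and with the sum over the \<open>Q\<close>-chains \<open>m\<^sub>i, \<dots>, m\<^sub>j\<close> as the
  \<open>(i, j)\<close> entry for \<open>i \<le> j\<close> (theorem \<open>chain_sum_eq_det\<close>). Expanded, the determinant is
  inclusion-exclusion over the positions at which a word violates \<open>R\<close>.

  For \<open>R\<close> equal to \<open><\<close>, the complement is \<open>\<ge>\<close>; a word that decreases weakly is the reversal of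
  one that increases weakly, so the entries are values of \<open>\<zeta>\<^sup>\<star>\<close> at the reversed arguments. For \<open>R\<close>
  equal to \<open>\<le>\<close>, the roles of the two zeta functions are exchanged.

  The proof of the chain identity replaces the expansion by a telescope of row operations. Let
  \<open>E p j\<close> be the sum over the words \<open>m\<^sub>0, \<dots>, m\<^sub>j\<close> that are an \<open>R\<close>-chain up to position \<open>p\<close> and a
  \<open>Q\<close>-chain from position \<open>p\<close> on. Then \<open>E 0 j\<close> is the first row of the matrix, and \<open>E p p\<close> is the
  \<open>R\<close>-chain sum on the first \<open>p + 1\<close> positions. Multiplying \<open>E p p\<close> by the \<open>Q\<close>-chain sum on
  \<open>p + 1, \<dots>, j\<close> joins two chains with no condition between them. Either \<open>Q\<close> or \<open>R\<close> holds at the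
  joint, so the product is \<open>E p j + E (p + 1) j\<close> (\<open>append_chains_eq_switch_words\<close>). Hence subtracting \<open>E p p\<close> times the second row
  from the first clears the corner and turns the row of the \<open>E p j\<close> into that of the
  \<open>- E (p + 1) j\<close>; expansion along the first column then removes one row and one column, until
  the last \<open>R\<close>-chain sum is left (\<open>det_hessenberg_telescope\<close>).
\<close>

section \<open>Hessenberg determinants\<close>

definition hessenberg :: "(nat \<Rightarrow> nat \<Rightarrow> 'a) \<Rightarrow> nat \<Rightarrow> nat \<Rightarrow> 'a :: comm_ring_1" where
  "hessenberg x i j = (if i \<le> j then x i j else if i = Suc j then 1 else 0)"

text \<open>
  The matrix below is the lower right corner, from row and column \<open>p\<close> on, with its first row
  replaced by \<open>E p\<close>. The hypothesis says that a row operation clears the corner entry \<open>E p p\<close> and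
  leaves the negative of \<open>E (Suc p)\<close>, so the determinant does not depend on \<open>p\<close>; at \<open>p = n - 1\<close>
  the matrix has a single entry.
\<close>

lemma det_hessenberg_corner:
  fixes x E :: "nat \<Rightarrow> nat \<Rightarrow> 'a :: comm_ring_1"
  assumes step: "\<And>p j. p < j \<Longrightarrow> j < n \<Longrightarrow> E p p * x (Suc p) j = E p j + E (Suc p) j"
    and "p + m = n" "0 < m"
  shows "det (mat m m (\<lambda>(i, j). if i = 0 then E p (p + j) else hessenberg x (p + i) (p + j)))
       = E (n - 1) (n - 1)"
  using assms(2,3)
proof (induction m arbitrary: p)
  case 0
  then show ?case by simp
next
  case (Suc m)
  define M where "M = mat (Suc m) (Suc m)
    (\<lambda>(i, j). if i = 0 then E p (p + j) else hessenberg x (p + i) (p + j))"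
  have M: "M \<in> carrier_mat (Suc m) (Suc m)"
    by (simp add: M_def)
  show ?case
  proof (cases "m = 0")
    case True
    have "det M = E p p"
      using True M by (simp add: det_single M_def)
    with True Suc.prems show ?thesis
      by (auto simp: M_def)
  next
    case False
    define N where "N = mat m m
      (\<lambda>(i, j). if i = 0 then E (Suc p) (Suc p + j) else hessenberg x (Suc p + i) (Suc p + j))"
    have N: "N \<in> carrier_mat m m"
      by (simp add: N_def)
    define M' where "M' = addrow (- E p p) 0 1 M"
    have M': "M' \<in> carrier_mat (Suc m) (Suc m)"
      using M by (simp add: M'_def)
    \<comment> \<open>The entry 1 of the second row cancels the corner, and it is the only one left in column 0.\<close>
    have column: "M' $$ (i, 0) = (if i = 1 then 1 else 0)" if "i < Suc m" for i
      using that False by (auto simp: M'_def M_def hessenberg_def mat_addrow_gen_def)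
    have "mat_delete M' 1 0 = multrow 0 (- 1) N"
    proof (rule eq_matI)
      fix i j
      assume "i < dim_row (multrow 0 (- 1) N)" "j < dim_col (multrow 0 (- 1) N)"
      then have ij: "i < m" "j < m"
        using N by simp_all
      show "mat_delete M' 1 0 $$ (i, j) = multrow 0 (- 1) N $$ (i, j)"
      proof (cases "i = 0")
        case True
        have "E p p * x (Suc p) (Suc (p + j)) = E p (Suc (p + j)) + E (Suc p) (Suc (p + j))"
          using step[of p "Suc (p + j)"] ij Suc.prems by simp
        then show ?thesis
          using ij True
          by (simp add: mat_delete_def M'_def M_def N_def hessenberg_def mat_addrow_gen_def
              mat_multrow_gen_def)
      next
        case False
        then show ?thesis
          using ij
          by (simp add: mat_delete_def M'_def M_def N_def hessenberg_def mat_addrow_gen_def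
              mat_multrow_gen_def)
      qed
    qed (use M' N in simp_all)
    then have minor: "det (mat_delete M' 1 0) = - det N"
      using det_multrow[OF _ N, of 0 "- 1"] False by simp
    have "det M = det M'"
      using det_addrow[OF _ _ M, of 1 0] False by (simp add: M'_def)
    also have "\<dots> = (\<Sum>i<Suc m. M' $$ (i, 0) * cofactor M' i 0)"
      by (rule laplace_expansion_column[OF M']) simp
    also have "\<dots> = (\<Sum>i<Suc m. if i = 1 then cofactor M' 1 0 else 0)"
      by (intro sum.cong) (auto simp: column)
    also have "\<dots> = cofactor M' 1 0"
      using False by (simp add: sum.delta)
    also have "\<dots> = det N"
      using minor by (simp add: cofactor_def)
    also have "\<dots> = E (n - 1) (n - 1)"
      unfolding N_def using Suc.IH[of "Suc p"] Suc.prems False by simp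
    finally show ?thesis
      by (simp add: M_def)
  qed
qed

lemma det_hessenberg_telescope:
  fixes x E :: "nat \<Rightarrow> nat \<Rightarrow> 'a :: comm_ring_1"
  assumes "\<And>p j. p < j \<Longrightarrow> j < n \<Longrightarrow> E p p * x (Suc p) j = E p j + E (Suc p) j"
    and "\<And>j. j < n \<Longrightarrow> E 0 j = x 0 j" and "0 < n"
  shows "det (mat n n (\<lambda>(i, j). hessenberg x i j)) = E (n - 1) (n - 1)"
proof -
  have "mat n n (\<lambda>(i, j). hessenberg x i j)
      = mat n n (\<lambda>(i, j). if i = 0 then E 0 (0 + j) else hessenberg x (0 + i) (0 + j))"
    using assms(2) by (intro eq_matI) (auto simp: hessenberg_def)
  with det_hessenberg_corner[of n E x 0 n] assms show ?thesis
    by simp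
qed

section \<open>Sums over words\<close>

definition words :: "'a set \<Rightarrow> nat \<Rightarrow> 'a list set" where
  "words S n = {ms. length ms = n \<and> set ms \<subseteq> S}"

text \<open>The offset \<open>i\<close> lets a factor of a word keep the functions of the positions that it
  occupies in the whole word.\<close>

definition weight :: "(nat \<Rightarrow> 'a \<Rightarrow> 'b) \<Rightarrow> nat \<Rightarrow> 'a list \<Rightarrow> 'b :: comm_monoid_mult" where
  "weight f i ms = (\<Prod>k<length ms. f (i + k) (ms ! k))"

lemma weight_Cons: "weight f i (m # ms) = f i m * weight f (Suc i) ms"
  unfolding weight_def by (simp add: prod.lessThan_Suc_shift del: prod.lessThan_Suc)

lemma weight_append: "weight f i (xs @ ys) = weight f i xs * weight f (i + length xs) ys"
  by (induction xs arbitrary: i) (simp_all add: weight_Cons mult.assoc, simp add: weight_def)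

lemma abs_summable_weight:
  fixes f :: "nat \<Rightarrow> 'a \<Rightarrow> 'b :: {real_normed_field, banach}"
  assumes "\<And>k. k < n \<Longrightarrow> f (i + k) abs_summable_on S"
  shows "weight f i abs_summable_on words S n"
  using assms
proof (induction n arbitrary: i)
  case 0
  have "words S 0 = {[]}"
    by (auto simp: words_def)
  then show ?case
    by simp
next
  case (Suc n)
  have tail: "weight f (Suc i) abs_summable_on words S n"
    using Suc.IH[of "Suc i"] Suc.prems[of "Suc _"] by simp
  have head: "f i abs_summable_on S"
    using Suc.prems[of 0] by simp
  have "(\<lambda>(x, xs). f i x * weight f (Suc i) xs) abs_summable_on S \<times> words S n"
    unfolding abs_summable_on_Sigma_iff
    using head tail
    by (auto simp: norm_mult infsum_cmult_right' abs_mult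
        intro!: summable_on_cmult_right summable_on_cmult_left)
  then have "((\<lambda>ms. norm (weight f i ms)) \<circ> (\<lambda>(x, xs). x # xs)) summable_on S \<times> words S n"
    by (simp add: o_def case_prod_unfold weight_Cons)
  moreover have "inj_on (\<lambda>(x, xs). x # xs) (S \<times> words S n)"
    by (auto simp: inj_on_def)
  moreover have "words S (Suc n) = (\<lambda>(x, xs). x # xs) ` (S \<times> words S n)"
    by (auto simp: words_def length_Suc_conv image_iff)
  ultimately show ?case
    using summable_on_reindex by metis
qed

text \<open>
  A product of two sums over words is a sum over concatenations: words of a fixed length split
  uniquely, and absolute convergence permits the rearrangement.
\<close>

lemma infsum_weight_append:
  fixes f :: "nat \<Rightarrow> 'a \<Rightarrow> 'b :: {real_normed_field, banach}"
  assumes summable: "weight f i summable_on words S (a + b)"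
    and A: "A \<subseteq> words S a" and B: "B \<subseteq> words S b"
  shows "infsum (weight f i) A * infsum (weight f (i + a)) B
       = infsum (weight f i) ((\<lambda>(xs, ys). xs @ ys) ` (A \<times> B))"
proof -
  let ?app = "\<lambda>(xs :: 'a list, ys). xs @ ys"
  have "length xs = a" if "xs \<in> A" for xs
    using A that by (auto simp: words_def)
  then have inj: "inj_on ?app (A \<times> B)"
    by (auto simp: inj_on_def)
  have "?app ` (A \<times> B) \<subseteq> words S (a + b)"
    using A B by (fastforce simp: words_def)
  then have "weight f i summable_on ?app ` (A \<times> B)"
    by (rule summable_on_subset_banach[OF summable])
  then have "(weight f i \<circ> ?app) summable_on A \<times> B"
    by (simp add: summable_on_reindex[OF inj])
  then have "infsum (weight f i \<circ> ?app) (A \<times> B)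
      = (\<Sum>\<^sub>\<infinity>xs\<in>A. \<Sum>\<^sub>\<infinity>ys\<in>B. (weight f i \<circ> ?app) (xs, ys))"
    by (rule infsum_Sigma_banach[symmetric])
  also have "\<dots> = (\<Sum>\<^sub>\<infinity>xs\<in>A. \<Sum>\<^sub>\<infinity>ys\<in>B. weight f i xs * weight f (i + a) ys)"
    using A by (intro infsum_cong) (auto simp: weight_append words_def)
  also have "\<dots> = infsum (weight f i) A * infsum (weight f (i + a)) B"
    by (simp add: infsum_cmult_right' infsum_cmult_left')
  finally show ?thesis
    by (simp add: infsum_reindex[OF inj])
qed

section \<open>Chain sums\<close>

text \<open>
  Only neighbours are compared: at each of these places a word satisfies either \<open>R\<close> or its
  complement, so the two relations can be treated alike whether or not they are transitive.
\<close>

definition chain_sum ::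
    "(nat \<Rightarrow> 'a \<Rightarrow> 'b) \<Rightarrow> 'a set \<Rightarrow> ('a \<Rightarrow> 'a \<Rightarrow> bool) \<Rightarrow> nat \<Rightarrow> nat \<Rightarrow> 'b :: {real_normed_field, banach}"
  where "chain_sum f S R i n = infsum (weight f i) {ms \<in> words S n. successively R ms}"

text \<open>
  Position \<open>p\<close>, where the condition switches from \<open>R\<close> to its complement, belongs to both parts;
  so all neighbours are constrained. The words have the positions \<open>0, \<dots>, j\<close>.
\<close>

definition switch_words :: "'a set \<Rightarrow> ('a \<Rightarrow> 'a \<Rightarrow> bool) \<Rightarrow> nat \<Rightarrow> nat \<Rightarrow> 'a list set" where
  "switch_words S R p j =
     {ms \<in> words S (Suc j). successively R (take (Suc p) ms)
        \<and> successively (\<lambda>x y. \<not> R x y) (drop p ms)}"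

text \<open>
  In a concatenation the neighbours at the joint, \<open>p\<close> and \<open>p + 1\<close>, are unconstrained. If \<open>R\<close> fails
  there, the switch happens at \<open>p\<close>; if \<open>R\<close> holds, it happens at \<open>p + 1\<close>. For \<open>switch_words S R p p\<close>
  the part after the switch is a single letter, so these words are just the \<open>R\<close>-chains.
\<close>

lemma append_chains_eq_switch_words:
  assumes "p < j"
  shows "(\<lambda>(xs, ys). xs @ ys) ` (switch_words S R p p
            \<times> {ys \<in> words S (j - p). successively (\<lambda>x y. \<not> R x y) ys})
       = switch_words S R p j \<union> switch_words S R (Suc p) j"
    and "switch_words S R p j \<inter> switch_words S R (Suc p) j = {}"
proof -
  let ?Q = "\<lambda>x y. \<not> R x y"
  have split: "take (Suc (Suc p)) ms = take (Suc p) ms @ [ms ! Suc p]"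
      "drop p ms = ms ! p # drop (Suc p) ms" "hd (drop (Suc p) ms) = ms ! Suc p"
      "drop (Suc p) ms \<noteq> []" "last (take (Suc p) ms) = ms ! p" "take (Suc p) ms \<noteq> []"
    if "length ms = Suc j" for ms :: "'a list"
    using that assms
    by (auto simp: take_Suc_conv_app_nth Cons_nth_drop_Suc hd_drop_conv_nth)
  have first: "ms \<in> switch_words S R p j \<longleftrightarrow> ms \<in> words S (Suc j)
      \<and> successively R (take (Suc p) ms) \<and> successively ?Q (drop (Suc p) ms)
      \<and> \<not> R (ms ! p) (ms ! Suc p)" for ms
    using assms by (auto simp: switch_words_def words_def split successively_Cons)
  have second: "ms \<in> switch_words S R (Suc p) j \<longleftrightarrow> ms \<in> words S (Suc j)
      \<and> successively R (take (Suc p) ms) \<and> successively ?Q (drop (Suc p) ms)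
      \<and> R (ms ! p) (ms ! Suc p)" for ms
    using assms by (auto simp: switch_words_def words_def split successively_append_iff)
  show "switch_words S R p j \<inter> switch_words S R (Suc p) j = {}"
    using first second by blast
  have single: "successively ?Q (drop p xs)" if "length xs = Suc p" for xs
    using that by (simp add: successively_conv_nth)
  show "(\<lambda>(xs, ys). xs @ ys) ` (switch_words S R p p
            \<times> {ys \<in> words S (j - p). successively ?Q ys})
       = switch_words S R p j \<union> switch_words S R (Suc p) j" (is "?L = ?R")
  proof (rule Set.set_eqI)
    fix ms
    have "ms \<in> ?R \<longleftrightarrow> ms \<in> words S (Suc j)
        \<and> successively R (take (Suc p) ms) \<and> successively ?Q (drop (Suc p) ms)"
      using first second by blast
    also have "\<dots> \<longleftrightarrow> ms \<in> ?L"
    proof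
      assume ms: "ms \<in> words S (Suc j)
        \<and> successively R (take (Suc p) ms) \<and> successively ?Q (drop (Suc p) ms)"
      then have "take (Suc p) ms \<in> switch_words S R p p"
        using assms single[of "take (Suc p) ms"]
        by (auto simp: switch_words_def words_def dest: in_set_takeD)
      moreover have "drop (Suc p) ms \<in> {ys \<in> words S (j - p). successively ?Q ys}"
        using ms by (auto simp: words_def dest: in_set_dropD)
      ultimately show "ms \<in> ?L"
        by (intro image_eqI[of _ _ "(take (Suc p) ms, drop (Suc p) ms)"]) auto
    next
      assume "ms \<in> ?L"
      then show "ms \<in> words S (Suc j)
        \<and> successively R (take (Suc p) ms) \<and> successively ?Q (drop (Suc p) ms)"
        using assms by (auto simp: switch_words_def words_def)
    qed
    finally show "ms \<in> ?L \<longleftrightarrow> ms \<in> ?R"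
      by blast
  qed
qed

text \<open>
  The sums over \<open>switch_words\<close> serve as the auxiliary rows: by the lemma above they satisfy the
  relation that the telescope requires.
\<close>

theorem chain_sum_eq_det:
  fixes f :: "nat \<Rightarrow> 'a \<Rightarrow> 'b :: {real_normed_field, banach}"
  assumes f: "\<And>k. k < n \<Longrightarrow> f k abs_summable_on S" and "0 < n"
  shows "chain_sum f S R 0 n
       = det (mat n n (\<lambda>(i, j). hessenberg (\<lambda>i j. chain_sum f S (\<lambda>x y. \<not> R x y) i (Suc j - i)) i j))"
proof -
  let ?Q = "\<lambda>x y. \<not> R x y"
  define E where "E p j = infsum (weight f 0) (switch_words S R p j)" for p j
  have summable: "weight f 0 summable_on words S m" if "m \<le> n" for m
    using that f by (intro abs_summable_summable[OF abs_summable_weight]) simp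
  have single: "successively ?Q (drop (n - 1) ms)" if "length ms = n" for ms
    using that \<open>0 < n\<close> by (auto simp: successively_conv_nth)
  have "E p p * chain_sum f S ?Q (Suc p) (Suc j - Suc p) = E p j + E (Suc p) j"
    if "p < j" "j < n" for p j
  proof -
    have "E p p * chain_sum f S ?Q (0 + Suc p) (j - p)
        = infsum (weight f 0) (switch_words S R p j \<union> switch_words S R (Suc p) j)"
      unfolding E_def chain_sum_def append_chains_eq_switch_words(1)[OF that(1), symmetric]
      using that by (intro infsum_weight_append) (auto simp: switch_words_def intro!: summable)
    also have "\<dots> = E p j + E (Suc p) j"
      unfolding E_def
      using that by (intro infsum_Un_disjoint append_chains_eq_switch_words(2)
          summable_on_subset_banach[OF summable[of "Suc j"]]) (auto simp: switch_words_def)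
    finally show ?thesis
      by simp
  qed
  moreover have "E 0 j = chain_sum f S ?Q 0 (Suc j - 0)" for j
    unfolding E_def chain_sum_def
    by (intro arg_cong[where f = "infsum (weight f 0)"])
      (auto simp: switch_words_def words_def length_Suc_conv)
  ultimately have "det (mat n n (\<lambda>(i, j). hessenberg (\<lambda>i j. chain_sum f S ?Q i (Suc j - i)) i j))
      = E (n - 1) (n - 1)"
    using \<open>0 < n\<close> by (intro det_hessenberg_telescope) auto
  also have "E (n - 1) (n - 1) = chain_sum f S R 0 n"
    unfolding E_def chain_sum_def
    using \<open>0 < n\<close> single by (intro arg_cong[where f = "infsum (weight f 0)"])
      (auto simp: switch_words_def words_def)
  finally show ?thesis
    by simp
qed

section \<open>Multiple zeta values\<close>

text \<open>The exponents are numbered from 1 and the positions of a word from 0.\<close>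

abbreviation zeta_term :: "(nat \<Rightarrow> complex) \<Rightarrow> nat \<Rightarrow> nat \<Rightarrow> complex" where
  "zeta_term s k m \<equiv> of_nat m powr (- s (Suc k))"

lemma abs_summable_nat_powr:
  assumes "Re z > 1"
  shows "(\<lambda>m. of_nat m powr (- z)) abs_summable_on {0 :: nat <..}"
proof -
  have "(\<lambda>m. real m powr (- Re z)) summable_on UNIV"
    using assms by (simp add: summable_on_UNIV_nonneg_real_iff summable_real_powr_iff)
  then have "(\<lambda>m. real m powr (- Re z)) summable_on {0 <..}"
    by (rule summable_on_subset_banach) simp
  then show ?thesis
    by (simp add: norm_powr_real_powr)
qed

text \<open>Sortedness compares all pairs of positions; for a transitive relation neighbours suffice.\<close>

lemma infsum_sorted_eq_chain_sum:
  assumes "transp R"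
  shows "(\<Sum>\<^sub>\<infinity>ms \<in> {ms :: nat list. length ms = length (map s [Suc 0..<Suc n])
            \<and> (\<forall>m \<in> set ms. 0 < m) \<and> sorted_wrt R ms}.
           \<Prod>k<length (map s [Suc 0..<Suc n]). of_nat (ms ! k) powr (- (map s [Suc 0..<Suc n] ! k)))
       = chain_sum (zeta_term s) {0 <..} R 0 n"
  unfolding chain_sum_def
  by (rule infsum_cong_neutral)
    (auto simp: words_def weight_def successively_conv_sorted_wrt[OF assms] simp del: upt_Suc)

text \<open>
  The matrix entries list their arguments in decreasing order of index. Reversing the word of
  summation indices as well restores the order of the arguments and replaces \<open>R\<close> by its converse.
\<close>

lemma infsum_sorted_rev_eq_chain_sum:
  fixes s i j
  defines "ss \<equiv> map s (rev [Suc i..<Suc (Suc j)])"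
  assumes "transp R"
  shows "(\<Sum>\<^sub>\<infinity>ms \<in> {ms :: nat list. length ms = length ss
            \<and> (\<forall>m \<in> set ms. 0 < m) \<and> sorted_wrt R ms}.
           \<Prod>k<length ss. of_nat (ms ! k) powr (- (ss ! k)))
       = chain_sum (zeta_term s) {0 <..} (\<lambda>x y. R y x) i (Suc j - i)"
proof -
  have flip: "transp (\<lambda>x y. R y x)"
    using \<open>transp R\<close> unfolding transp_def by blast
  show ?thesis
    unfolding chain_sum_def
  proof (rule infsum_reindex_bij_witness[of _ rev rev])
    fix ms :: "nat list"
    assume "ms \<in> {ms. length ms = length ss \<and> (\<forall>m \<in> set ms. 0 < m) \<and> sorted_wrt R ms}"
    then have len: "length ms = Suc j - i"
      by (simp add: ss_def del: upt_Suc)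
    have "weight (zeta_term s) i (rev ms)
        = (\<Prod>k<Suc j - i. of_nat (ms ! (Suc j - i - Suc k)) powr (- s (Suc (i + k))))"
      by (simp add: weight_def len rev_nth)
    also have "\<dots> = (\<Prod>k<Suc j - i. of_nat (ms ! k) powr (- s (Suc (i + (Suc j - i - Suc k)))))"
      by (subst prod.nat_diff_reindex[symmetric]) (auto intro!: prod.cong)
    also have "\<dots> = (\<Prod>k<length ss. of_nat (ms ! k) powr (- (ss ! k)))"
      by (rule prod.cong) (auto simp: ss_def rev_nth simp del: upt_Suc)
    finally show "weight (zeta_term s) i (rev ms)
        = (\<Prod>k<length ss. of_nat (ms ! k) powr (- (ss ! k)))" .
  qed (auto simp: ss_def words_def sorted_wrt_rev successively_conv_sorted_wrt[OF \<open>transp R\<close>]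
        successively_conv_sorted_wrt[OF flip] simp del: upt_Suc)
qed

theorem corollary1p2:
  fixes s :: "nat \<Rightarrow> complex" and n :: nat
  assumes "n \<ge> 1"
    and "\<And>i. i \<in> {1..n} \<Longrightarrow> Re (s i) > 1"
  shows "mzeta (map s [1..<Suc n]) = Determinant.det (mat n n (\<lambda>(i, j). x_entry s (i + 1) (j + 1)))
       \<and> mzeta_star (map s [1..<Suc n]) = Determinant.det (mat n n (\<lambda>(i, j). y_entry s (i + 1) (j + 1)))"
proof -
  have summable: "zeta_term s k abs_summable_on {0 <..}" if "k < n" for k
    using that assms(2)[of "Suc k"] by (intro abs_summable_nat_powr) simp
  have "x_entry s (i + 1) (j + 1) = hessenberg
      (\<lambda>i j. chain_sum (zeta_term s) {0 <..} (\<lambda>x y. \<not> x < y) i (Suc j - i)) i j" for i j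
    using infsum_sorted_rev_eq_chain_sum[of "(\<le>)" s i j]
    by (simp add: x_entry_def hessenberg_def mzeta_star_def not_less del: upt_Suc)
  moreover have "y_entry s (i + 1) (j + 1) = hessenberg
      (\<lambda>i j. chain_sum (zeta_term s) {0 <..} (\<lambda>x y. \<not> x \<le> y) i (Suc j - i)) i j" for i j
    using infsum_sorted_rev_eq_chain_sum[of "(<)" s i j]
    by (simp add: y_entry_def hessenberg_def mzeta_def not_le del: upt_Suc)
  moreover have "mzeta (map s [1..<Suc n]) = chain_sum (zeta_term s) {0 <..} (<) 0 n"
    using infsum_sorted_eq_chain_sum[of "(<)" s n]
    by (simp add: mzeta_def del: upt_Suc)
  moreover have "mzeta_star (map s [1..<Suc n]) = chain_sum (zeta_term s) {0 <..} (\<le>) 0 n"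
    using infsum_sorted_eq_chain_sum[of "(\<le>)" s n]
    by (simp add: mzeta_star_def del: upt_Suc)
  ultimately show ?thesis
    using chain_sum_eq_det[OF summable, of n] assms(1) by simp
qed

end
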